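(* Let $A\in\mathbb{R}^{m\times n}$, $b\in\mathbb{R}^m$, $\tau>0$, $p>0$ and $\sigma>0$, and define $H_{p,\sigma}:\mathbb{R}^n\to\mathbb{R}$ by $$H_{p,\sigma}(x):=\|Ax-b\|_2^2+2\tau\left(\sum_{k=1}^n\phi_\sigma(x_k)^p\right)^{1/p}.$$ Then the gradient is given by $$\nabla H_{p,\sigma}(x)=2A^T(Ax-b)+2\tau\left(\sum_{k=1}^n\phi_\sigma(x_k)^p\right)^{(1-p)/p}\left\{\phi_\sigma(x_j)^{p-1}\operatorname{erf}\left(\frac{x_j}{\sqrt2\,\sigma}\right)\right\}_{j=1}^n,$$ and the Hessian is given by $$\nabla^2H_{p,\sigma}(x)=2A^TA+2\tau\left(v(x)v(x)^T+\operatorname{Diag}\bigl(w(x)\bigr)\right),$$ where the functions $v,w:\mathbb{R}^n\to\mathbb{R}^n$ are defined for all $x\in\mathbb{R}^n$ by $$v(x):=\left\{\sqrt{1-p}\,\phi_\sigma(x_j)^{p-1}\operatorname{erf}\left(\frac{x_j}{\sqrt2\,\sigma}\right)\left(\sum_{k=1}^n\phi_\sigma(x_k)^p\right)^{(1-2p)/(2p)}\right\}_{j=1}^n,$$ $$w(x):=\left(\sum_{k=1}^n\phi_\sigma(x_k)^p\right)^{(1-p)/p}\left\{(p-1)\phi_\sigma(x_j)^{p-2}\left(\operatorname{erf}\left(\frac{x_j}{\sqrt2\,\sigma}\right)\right)^2+\frac{\sqrt2}{\sigma\sqrt\pi}\phi_\sigma(x_j)^{p-1}\exp\left(-\frac{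x_j^2}{2\sigma^2}\right)\right\}_{j=1}^n.$$
   Context: The error function is $\operatorname{erf}(t)=\frac{2}{\sqrt\pi}\int_0^t\exp(-u^2)\,\mathrm{d}u$ for $t\in\mathbb{R}$. For $\sigma>0$, $\phi_\sigma:\mathbb{R}\to\mathbb{R}$ is the convolution of the absolute value with the Gaussian of standard deviation $\sigma$: $\phi_\sigma(t)=\frac{1}{\sqrt{2\pi\sigma^2}}\int_{-\infty}^{\infty}|t-s|\exp\left(-\frac{s^2}{2\sigma^2}\right)\mathrm{d}s = t\operatorname{erf}\left(\frac{t}{\sqrt2\,\sigma}\right)+\sqrt{\frac2\pi}\,\sigma\exp\left(-\frac{t^2}{2\sigma^2}\right)$. $\|\cdot\|_2$ is the Euclidean norm. $\{a_j\}_{j=1}^n$ denotes the (column) vector with $j$-th entry $a_j$. $\operatorname{Diag}:\mathbb{R}^n\to\mathbb{R}^{n\times n}$ sends a vector to the diagonal matrix with that vector's entries on the diagonal.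
   Formalization: For p>1 the number √(1−p) is not real, so v does not map into ℝⁿ as stated; the Hessian formula is proved with real v for 0<p≤1, and for all p>0 with √(1−p) read as the principal complex square root, so v takes values in ℂⁿ and vvᵀ uses the plain transpose. *)

theory Defs
  imports "HOL-Analysis.Analysis"
begin

(* The interval integral is oriented, so this also covers t < 0. *)
definition erf :: "real \<Rightarrow> real" where
  "erf t = 2 / sqrt pi * (LBINT u=0..t. exp (- u\<^sup>2))"

definition phi :: "real \<Rightarrow> real \<Rightarrow> real" where
  "phi \<sigma> t = 1 / sqrt (2 * pi * \<sigma>\<^sup>2) *
     (LINT s|lborel. \<bar>t - s\<bar> * exp (- (s\<^sup>2 / (2 * \<sigma>\<^sup>2))))"

definition phi_sum :: "real \<Rightarrow> real \<Rightarrow> real^'n \<Rightarrow> real" where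
  "phi_sum p \<sigma> x = (\<Sum>k\<in>UNIV. phi \<sigma> (x $ k) powr p)"

definition H :: "real^'n^'m \<Rightarrow> real^'m \<Rightarrow> real \<Rightarrow> real \<Rightarrow> real \<Rightarrow> real^'n \<Rightarrow> real" where
  "H A b \<tau> p \<sigma> x = (norm (A *v x - b))\<^sup>2 + 2 * \<tau> * phi_sum p \<sigma> x powr (1 / p)"

definition Diag :: "'a::zero^'n \<Rightarrow> 'a^'n^'n" where
  "Diag v = (\<chi> i j. if i = j then v $ i else 0)"

(* v v^T; for complex vectors this is the plain transpose, without conjugation. *)
definition outer_square :: "'a::semiring_1^'n \<Rightarrow> 'a^'n^'n" where
  "outer_square v = (columnvector v :: 'a^1^'n) ** (rowvector v :: 'a^'n^1)"

(* M is the Jacobian of the gradient: f has a gradient G throughout a neighbourhood of x,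
   and G is Frechet differentiable at x with matrix M. *)
definition has_hessian :: "(real^'n \<Rightarrow> real) \<Rightarrow> real^'n^'n \<Rightarrow> real^'n \<Rightarrow> bool" where
  "has_hessian f M x \<longleftrightarrow>
     (\<exists>G. (\<forall>\<^sub>F y in nhds x. GDERIV f y :> G y) \<and> (G has_derivative (\<lambda>h. M *v h)) (at x))"

(* Meant for p \<le> 1: the library's sqrt is odd, so sqrt (1 - p) squares to p - 1 for p > 1. *)
definition v_real :: "real \<Rightarrow> real \<Rightarrow> real^'n \<Rightarrow> real^'n" where
  "v_real p \<sigma> x = (\<chi> j. sqrt (1 - p) * phi \<sigma> (x $ j) powr (p - 1) * erf (x $ j / (sqrt 2 * \<sigma>))
     * phi_sum p \<sigma> x powr ((1 - 2 * p) / (2 * p)))"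

(* The same vector with the principal complex root, imaginary for p > 1. *)
definition v_complex :: "real \<Rightarrow> real \<Rightarrow> real^'n \<Rightarrow> complex^'n" where
  "v_complex p \<sigma> x = (\<chi> j. csqrt (1 - of_real p) *
     of_real (phi \<sigma> (x $ j) powr (p - 1) * erf (x $ j / (sqrt 2 * \<sigma>))
       * phi_sum p \<sigma> x powr ((1 - 2 * p) / (2 * p))))"

definition w :: "real \<Rightarrow> real \<Rightarrow> real^'n \<Rightarrow> real^'n" where
  "w p \<sigma> x = phi_sum p \<sigma> x powr ((1 - p) / p) *\<^sub>R
     (\<chi> j. (p - 1) * phi \<sigma> (x $ j) powr (p - 2) * (erf (x $ j / (sqrt 2 * \<sigma>)))\<^sup>2
        + sqrt 2 / (\<sigma> * sqrt pi) * phi \<sigma> (x $ j) powr (p - 1)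
            * exp (- ((x $ j)\<^sup>2 / (2 * \<sigma>\<^sup>2))))"

end

theory Submission
  imports Defs "HOL-Probability.Distributions"
begin

text \<open>
Everything rests on one identity in one real variable: the derivative of \<^term>\<open>phi \<sigma>\<close> at \<open>t\<close> is
\<^term>\<open>erf (t / (sqrt 2 * \<sigma>))\<close>. Rather than differentiating under the integral sign, where the kink of
the absolute value is in the way, the integral is evaluated. Cut at the kink, it splits into two
Gaussian tail moments, one beyond \<open>t\<close> and one, after reflection, beyond \<open>- t\<close>. Up to erf, the integrand
of such a moment has an elementary primitive, whose limit at infinity is known from the Gaussian
integral (\<open>gaussian_tail_moment\<close>). The resulting \<open>phi_closed_form\<close> gives the derivative, since the two
Gaussian terms produced by differentiation cancel. It also gives \<open>phi_pos\<close>, and positivity is what makes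
every real power below differentiable, whatever its exponent.

The rest is the chain rule and the product rule. Let \<open>S\<close> stand for \<^term>\<open>phi_sum p \<sigma> x\<close> and \<open>g\<close> for
the vector with the entries \<^term>\<open>phi \<sigma> (x $ j) powr (p - 1) * erf (x $ j / (sqrt 2 * \<sigma>))\<close>. The
gradient of \<open>S\<close> is \<open>p\<close> times \<open>g\<close>, so the gradient of \<open>S powr (1 / p)\<close> is \<open>S powr ((1 - p) / p)\<close> times \<open>g\<close>.
In the second derivative, the power of \<open>S\<close> contributes \<open>(1 - p) * S powr ((1 - 2 * p) / p)\<close> times the
rank-one matrix built from \<open>g\<close>, while \<open>g\<close>, each entry of which depends on one coordinate only, contributes
a diagonal matrix. In this form (\<open>has_hessian_H\<close>) the Hessian makes sense over the reals for every
positive \<open>p\<close>. Only at the end is the factor \<open>1 - p\<close> distributed over the two copies of \<open>g\<close> as a square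
root, real for \<open>p \<le> 1\<close> (\<open>outer_square_v_real\<close>) and complex for arbitrary \<open>p\<close>
(\<open>outer_square_v_complex\<close>).
\<close>

section \<open>The error function\<close>

lemma DERIV_erf: "(erf has_real_derivative 2 / sqrt pi * exp (- t\<^sup>2)) (at t)"
proof -
  \<comment> \<open>The fundamental theorem is stated on a compact interval; this one has both \<open>0\<close> and \<open>t\<close> in its interior.\<close>
  define a where "a = - (\<bar>t\<bar> + 1)"
  define c where "c = \<bar>t\<bar> + 1"
  have "((\<lambda>y. LBINT u=ereal 0..ereal y. exp (- u\<^sup>2)) has_vector_derivative exp (- t\<^sup>2))
          (at t within {a..c})"
    by (rule interval_integral_FTC2) (auto simp: a_def c_def intro!: continuous_intros)
  then have "((\<lambda>y. LBINT u=0..ereal y. exp (- u\<^sup>2)) has_real_derivative exp (- t\<^sup>2)) (at t within {a..c})"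
    by (simp add: has_real_derivative_iff_has_vector_derivative zero_ereal_def)
  moreover have "at t within {a..c} = at t"
    by (rule at_within_interior) (auto simp: a_def c_def)
  ultimately have "((\<lambda>y. LBINT u=0..ereal y. exp (- u\<^sup>2)) has_real_derivative exp (- t\<^sup>2)) (at t)"
    by simp
  from DERIV_cmult[OF this, of "2 / sqrt pi"] show ?thesis
    by (simp add: erf_def[abs_def])
qed

lemma erf_0 [simp]: "erf 0 = 0"
  by (simp add: erf_def zero_ereal_def)

lemma erf_minus: "erf (- t) = - erf t"
proof -
  have "(LBINT u=0..ereal (- t). exp (- u\<^sup>2)) = (LBINT u=0..ereal t. - exp (- u\<^sup>2))"
    using interval_integral_reflect[of 0 "ereal (-t)" "\<lambda>u. exp (- u\<^sup>2)"]
      interval_integral_endpoints_reverse[of "-0" "ereal t" "\<lambda>u. exp (- u\<^sup>2)"]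
      interval_integral_endpoints_reverse[of 0 "ereal t" "\<lambda>u. exp (- u\<^sup>2)"]
    by (simp add: interval_lebesgue_integral_uminus)
  then show ?thesis
    by (simp add: erf_def interval_lebesgue_integral_uminus)
qed

text \<open>The error function increases through the origin, so it has the sign of its argument.\<close>

lemma mult_erf_nonneg:
  assumes "c > 0"
  shows "0 \<le> t * erf (t / c)"
proof -
  have mono: "erf s \<le> erf t" if "s \<le> t" for s t
    by (rule DERIV_nonneg_imp_nondecreasing[OF that]) (use DERIV_erf in fastforce)
  show ?thesis
    using mono[of 0 "t / c"] mono[of "t / c" 0] assms
    by (cases "t \<ge> 0") (auto simp: zero_le_mult_iff divide_le_0_iff)
qed

text \<open>The normalisation of erf is the value of the Gaussian integral over the half line.\<close>

lemma erf_tendsto_1: "(erf \<longlongrightarrow> 1) at_top"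
proof -
  let ?g = "\<lambda>u::real. exp (- u\<^sup>2)"
  have hb: "has_bochner_integral lborel (\<lambda>x. indicator {0..} x *\<^sub>R ?g x) (sqrt pi / 2)"
    by (rule gaussian_moment_0)
  then have "((\<lambda>y. LINT u:{0..y}|lborel. ?g u) \<longlongrightarrow> (LINT u:{0..}|lborel. ?g u)) at_top"
    by (intro tendsto_set_lebesgue_integral_at_top)
      (auto simp: set_integrable_def has_bochner_integral_iff)
  moreover have "(LINT u:{0..}|lborel. ?g u) = sqrt pi / 2"
    using hb by (simp add: set_lebesgue_integral_def has_bochner_integral_iff)
  ultimately have "((\<lambda>y. 2 / sqrt pi * (LINT u:{0..y}|lborel. ?g u)) \<longlongrightarrow> 2 / sqrt pi * (sqrt pi / 2)) at_top"
    by (intro tendsto_mult tendsto_const) simp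
  moreover have "\<forall>\<^sub>F y in at_top. 2 / sqrt pi * (LINT u:{0..y}|lborel. ?g u) = erf y"
    using eventually_ge_at_top[of 0]
    by eventually_elim (simp add: erf_def zero_ereal_def interval_integral_Icc)
  ultimately show ?thesis
    by (simp add: tendsto_cong)
qed

lemma DERIV_erf_scaled:
  assumes "\<sigma> > 0"
  shows "((\<lambda>t. erf (t / (sqrt 2 * \<sigma>))) has_real_derivative
           sqrt 2 / (\<sigma> * sqrt pi) * exp (- (t\<^sup>2 / (2 * \<sigma>\<^sup>2)))) (at t)"
proof -
  have "((\<lambda>t. erf (t / (sqrt 2 * \<sigma>))) has_real_derivative
        2 / sqrt pi * exp (- (t / (sqrt 2 * \<sigma>))\<^sup>2) * (1 / (sqrt 2 * \<sigma>))) (at t)"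
    by (rule DERIV_chain2[OF DERIV_erf]) (use assms in \<open>auto intro!: derivative_eq_intros\<close>)
  moreover have "2 / sqrt pi * exp (- (t / (sqrt 2 * \<sigma>))\<^sup>2) * (1 / (sqrt 2 * \<sigma>))
      = sqrt 2 / (\<sigma> * sqrt pi) * exp (- (t\<^sup>2 / (2 * \<sigma>\<^sup>2)))"
  proof -
    have "2 / sqrt pi * (1 / (sqrt 2 * \<sigma>)) = sqrt 2 / (\<sigma> * sqrt pi)"
      using assms by (simp add: divide_simps)
    moreover have "(t / (sqrt 2 * \<sigma>))\<^sup>2 = t\<^sup>2 / (2 * \<sigma>\<^sup>2)"
      by (simp add: power_divide power_mult_distrib)
    moreover have "a * e * c = a * c * e" for a e c :: real
      by simp
    ultimately show ?thesis
      by (simp only:)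
  qed
  ultimately show ?thesis
    by simp
qed

lemma DERIV_gauss:
  assumes "\<sigma> > 0"
  shows "((\<lambda>t. - \<sigma>\<^sup>2 * exp (- (t\<^sup>2 / (2 * \<sigma>\<^sup>2)))) has_real_derivative
           t * exp (- (t\<^sup>2 / (2 * \<sigma>\<^sup>2)))) (at t)"
proof -
  have "((\<lambda>t. - (t\<^sup>2 / (2 * \<sigma>\<^sup>2))) has_real_derivative - (t / \<sigma>\<^sup>2)) (at t)"
    using DERIV_minus[OF DERIV_cdivide[OF DERIV_pow[of 2 t], of "2 * \<sigma>\<^sup>2"]] by simp
  from DERIV_cmult[OF DERIV_chain2[OF DERIV_exp this], of "- \<sigma>\<^sup>2"] show ?thesis
    using assms by (simp add: mult.commute)
qed

section \<open>The smoothed absolute value\<close>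

text \<open>The integrand is nonnegative on the half line, so the fundamental theorem of calculus yields its integral
and its integrability at once.\<close>

lemma gaussian_tail_moment:
  assumes "\<sigma> > 0"
  shows "has_bochner_integral lborel
    (\<lambda>s. indicator {t..} s * ((s - t) * exp (- (s\<^sup>2 / (2 * \<sigma>\<^sup>2)))))
    (\<sigma>\<^sup>2 * exp (- (t\<^sup>2 / (2 * \<sigma>\<^sup>2))) - t * \<sigma> * sqrt (pi / 2) * (1 - erf (t / (sqrt 2 * \<sigma>))))"
    (is "has_bochner_integral _ (\<lambda>s. indicator _ s * ?f s) ?I")
proof -
  \<comment> \<open>The two summands are primitives of \<open>s * exp (- (s\<^sup>2 / (2 * \<sigma>\<^sup>2)))\<close> and of \<open>- t * exp (- (s\<^sup>2 / (2 * \<sigma>\<^sup>2)))\<close>.\<close>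
  define F where "F s = - \<sigma>\<^sup>2 * exp (- (s\<^sup>2 / (2 * \<sigma>\<^sup>2)))
      - t * \<sigma> * sqrt (pi / 2) * erf (s / (sqrt 2 * \<sigma>))" for s
  define T where "T = - t * \<sigma> * sqrt (pi / 2)"
  have sq: "(s / (sqrt 2 * \<sigma>))\<^sup>2 = s\<^sup>2 / (2 * \<sigma>\<^sup>2)" for s
    by (simp add: power_divide power_mult_distrib)
  have derF: "DERIV F s :> ?f s" for s
  proof -
    have c: "t * \<sigma> * sqrt (pi / 2) * (sqrt 2 / (\<sigma> * sqrt pi)) = t"
      using assms by (simp add: real_sqrt_divide)
    have e: "DERIV (\<lambda>s. t * \<sigma> * sqrt (pi / 2) * erf (s / (sqrt 2 * \<sigma>))) s :>
        t * exp (- (s\<^sup>2 / (2 * \<sigma>\<^sup>2)))"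
      using DERIV_cmult[OF DERIV_erf_scaled[OF assms], where c = "t * \<sigma> * sqrt (pi / 2)"]
      unfolding mult.assoc[symmetric] c[unfolded mult.assoc[symmetric]] .
    show ?thesis
      using DERIV_diff[OF DERIV_gauss[OF assms] e] by (simp add: F_def[abs_def] algebra_simps)
  qed
  have limF: "(F \<longlongrightarrow> T) at_top"
  proof -
    have "filterlim (\<lambda>s. s / (sqrt 2 * \<sigma>)) at_top at_top"
      using assms filterlim_tendsto_pos_mult_at_top[OF tendsto_const[of "1 / (sqrt 2 * \<sigma>)"] _ filterlim_ident]
      by (simp add: mult.commute)
    then have lin: "((\<lambda>s. erf (s / (sqrt 2 * \<sigma>))) \<longlongrightarrow> 1) at_top"
      and "filterlim (\<lambda>s. (s / (sqrt 2 * \<sigma>))^2) at_top at_top"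
      by (auto intro: filterlim_compose[OF erf_tendsto_1] filterlim_pow_at_top)
    then have "((\<lambda>s. exp (- (s\<^sup>2 / (2 * \<sigma>\<^sup>2)))) \<longlongrightarrow> 0) at_top"
      by (intro filterlim_compose[OF exp_at_bot]) (simp add: filterlim_uminus_at_bot sq)
    from tendsto_diff[OF tendsto_mult[OF tendsto_const[of "- \<sigma>\<^sup>2"] this]
        tendsto_mult[OF tendsto_const[of "t * \<sigma> * sqrt (pi / 2)"] lin]]
    show ?thesis by (simp add: F_def[abs_def] T_def)
  qed
  have "(\<integral>\<^sup>+s. ennreal (?f s) * indicator {t ..} s \<partial>lborel) = ennreal (T - F t)"
    by (rule nn_integral_FTC_atLeast[OF _ derF _ limF]) auto
  also have "T - F t = ?I"
    by (simp add: T_def F_def algebra_simps)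
  finally have nn: "(\<integral>\<^sup>+s. ennreal (indicator {t..} s * ?f s) \<partial>lborel) = ennreal ?I"
    by (subst (asm) nn_integral_cong[where v = "\<lambda>s. ennreal (indicator {t..} s * ?f s)"])
      (auto simp: indicator_def)
  \<comment> \<open>\<open>ennreal\<close> truncates negative reals, so the value found is the integral only once its sign is known.\<close>
  have "F t \<le> T"
  proof (rule tendsto_lowerbound[OF limF])
    show "\<forall>\<^sub>F s in at_top. F t \<le> F s"
      using eventually_ge_at_top[of t]
    proof eventually_elim
      case (elim s)
      show ?case
        by (rule DERIV_nonneg_imp_nondecreasing[OF elim]) (use derF in fastforce)
    qed
  qed simp
  then have "0 \<le> ?I"
    using \<open>T - F t = ?I\<close> by simp
  with nn show ?thesis
    by (intro has_bochner_integral_nn_integral) (auto simp: indicator_def)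
qed

text \<open>The part of the integral to the left of \<open>t\<close> is turned by \<open>s \<mapsto> - s\<close> into the tail moment at \<open>- t\<close>. Since erf is
odd, the constant multiples of \<open>t\<close> in the two tail moments cancel.\<close>

lemma phi_closed_form:
  assumes "\<sigma> > 0"
  shows "phi \<sigma> t = t * erf (t / (sqrt 2 * \<sigma>)) + sqrt (2 / pi) * \<sigma> * exp (- (t\<^sup>2 / (2 * \<sigma>\<^sup>2)))"
proof -
  let ?g = "\<lambda>s::real. exp (- (s\<^sup>2 / (2 * \<sigma>\<^sup>2)))"
  let ?J = "\<lambda>t. \<sigma>\<^sup>2 * ?g t - t * \<sigma> * sqrt (pi / 2) * (1 - erf (t / (sqrt 2 * \<sigma>)))"
  let ?k = "\<lambda>t s. indicator {t..} s * ((s - t) * ?g s)"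
  have "has_bochner_integral lborel (\<lambda>s. ?k (- t) (0 + (- 1) * s)) (?J (- t) /\<^sub>R \<bar>- 1\<bar>)"
    by (subst lborel_has_bochner_integral_real_affine_iff[symmetric])
      (use gaussian_tail_moment[OF assms, of "- t"] in simp_all)
  from has_bochner_integral_add[OF gaussian_tail_moment[OF assms, of t] this]
  have "has_bochner_integral lborel (\<lambda>s. ?k t s + ?k (- t) (- s)) (?J t + ?J (- t))"
    by simp
  also have "(\<lambda>s. ?k t s + ?k (- t) (- s)) = (\<lambda>s. \<bar>t - s\<bar> * ?g s)"
    by (auto simp: fun_eq_iff indicator_def abs_if)
  finally have "(LINT s|lborel. \<bar>t - s\<bar> * ?g s) = ?J t + ?J (- t)"
    by (rule has_bochner_integral_integral_eq)
  moreover have "1 / sqrt (2 * pi * \<sigma>\<^sup>2) * (?J t + ?J (- t)) =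
      t * erf (t / (sqrt 2 * \<sigma>)) + sqrt (2 / pi) * \<sigma> * ?g t"
  proof -
    have "?J t + ?J (- t) = 2 * \<sigma>\<^sup>2 * ?g t + 2 * \<sigma> * sqrt (pi / 2) * (t * erf (t / (sqrt 2 * \<sigma>)))"
      by (simp add: erf_minus algebra_simps)
    moreover have "1 / sqrt (2 * pi * \<sigma>\<^sup>2) * (2 * \<sigma>\<^sup>2) = sqrt (2 / pi) * \<sigma>"
      and "1 / sqrt (2 * pi * \<sigma>\<^sup>2) * (2 * \<sigma> * sqrt (pi / 2)) = 1"
      using assms by (simp_all add: real_sqrt_mult real_sqrt_divide field_simps power2_eq_square)
    ultimately show ?thesis
      by (simp only: distrib_left mult.assoc[symmetric])
  qed
  ultimately show ?thesis
    by (simp add: phi_def)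
qed

text \<open>The Gaussian summand of the closed form is positive and the other one is nonnegative.\<close>

lemma phi_pos:
  assumes "\<sigma> > 0"
  shows "phi \<sigma> t > 0"
  unfolding phi_closed_form[OF assms]
  using mult_erf_nonneg[of "sqrt 2 * \<sigma>" t] assms by (intro add_nonneg_pos) auto

lemma DERIV_phi:
  assumes "\<sigma> > 0"
  shows "(phi \<sigma> has_real_derivative erf (t / (sqrt 2 * \<sigma>))) (at t)"
proof -
  let ?g = "\<lambda>t. exp (- (t\<^sup>2 / (2 * \<sigma>\<^sup>2)))" and ?e = "\<lambda>t. erf (t / (sqrt 2 * \<sigma>))"
  \<comment> \<open>With this constant, the Gaussian terms from \<open>t * erf (t / (sqrt 2 * \<sigma>))\<close> and from the exponential cancel.\<close>
  have c: "sqrt 2 / (\<sigma> * sqrt pi) = sqrt (2 / pi) / \<sigma>"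
    by (simp add: real_sqrt_divide)
  have "((\<lambda>t. t * ?e t + (- (sqrt (2 / pi) / \<sigma>)) * (- \<sigma>\<^sup>2 * ?g t)) has_real_derivative
      (1 * ?e t + sqrt (2 / pi) / \<sigma> * ?g t * t) + (- (sqrt (2 / pi) / \<sigma>)) * (t * ?g t)) (at t)"
    unfolding c[symmetric]
    by (intro DERIV_add DERIV_mult DERIV_ident DERIV_erf_scaled DERIV_cmult DERIV_gauss assms)
  moreover have "(\<lambda>t. t * ?e t + (- (sqrt (2 / pi) / \<sigma>)) * (- \<sigma>\<^sup>2 * ?g t)) = phi \<sigma>"
    using assms by (simp add: fun_eq_iff phi_closed_form power2_eq_square)
  ultimately show ?thesis
    by simp
qed

lemma DERIV_phi_powr:
  assumes "\<sigma> > 0"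
  shows "((\<lambda>t. phi \<sigma> t powr a) has_real_derivative
           a * phi \<sigma> t powr (a - 1) * erf (t / (sqrt 2 * \<sigma>))) (at t)"
  using DERIV_fun_powr[OF DERIV_phi[OF assms] phi_pos[OF assms]] by simp

section \<open>Derivatives of the smoothed power sum\<close>

text \<open>The gradient of \<^term>\<open>phi_sum p \<sigma>\<close> divided by \<open>p\<close>; the gradient of every power of \<^term>\<open>phi_sum p \<sigma>\<close> is
a scalar multiple of it.\<close>

definition phi_dir :: "real \<Rightarrow> real \<Rightarrow> real^'n \<Rightarrow> real^'n" where
  "phi_dir p \<sigma> x = (\<chi> j. phi \<sigma> (x $ j) powr (p - 1) * erf (x $ j / (sqrt 2 * \<sigma>)))"

text \<open>The diagonal of the Jacobian of \<^term>\<open>phi_dir p \<sigma>\<close>, which is a diagonal matrix.\<close>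

definition phi_curv :: "real \<Rightarrow> real \<Rightarrow> real^'n \<Rightarrow> real^'n" where
  "phi_curv p \<sigma> x =
     (\<chi> j. (p - 1) * phi \<sigma> (x $ j) powr (p - 2) * (erf (x $ j / (sqrt 2 * \<sigma>)))\<^sup>2
        + sqrt 2 / (\<sigma> * sqrt pi) * phi \<sigma> (x $ j) powr (p - 1)
            * exp (- ((x $ j)\<^sup>2 / (2 * \<sigma>\<^sup>2))))"

lemma has_derivative_vec_componentwise:
  fixes f :: "'a::real_normed_vector \<Rightarrow> real^'n"
  assumes "\<And>j. ((\<lambda>x. f x $ j) has_derivative (\<lambda>h. f' h $ j)) (at x)"
  shows "(f has_derivative f') (at x)"
proof -
  have "((\<lambda>y. \<Sum>j\<in>UNIV. f y $ j *\<^sub>R (axis j 1 :: real^'n)) has_derivative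
        (\<lambda>h. \<Sum>j\<in>UNIV. f' h $ j *\<^sub>R (axis j 1 :: real^'n))) (at x)"
    by (intro has_derivative_sum has_derivative_scaleR_left assms)
  then show ?thesis
    by (simp only: scalar_mult_eq_scaleR[symmetric] basis_expansion)
qed

lemma has_derivative_nth: "((\<lambda>x::real^'n. x $ k) has_derivative (\<lambda>h. h $ k)) F"
  by (rule bounded_linear_imp_has_derivative[OF bounded_linear_vec_nth])

lemma phi_sum_pos:
  assumes "\<sigma> > 0"
  shows "phi_sum p \<sigma> x > 0"
  unfolding phi_sum_def using phi_pos[OF assms]
  by (intro sum_pos) (auto simp: less_imp_neq[symmetric])

lemma has_derivative_phi_sum:
  assumes "\<sigma> > 0"
  shows "(phi_sum p \<sigma> has_derivative (\<lambda>h. p * (h \<bullet> phi_dir p \<sigma> x))) (at x)"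
proof -
  have "((\<lambda>x. \<Sum>k\<in>UNIV. phi \<sigma> (x $ k) powr p) has_derivative
     (\<lambda>h. \<Sum>k\<in>UNIV. h $ k * (p * phi \<sigma> (x $ k) powr (p - 1) * erf (x $ k / (sqrt 2 * \<sigma>))))) (at x)"
    by (intro has_derivative_sum DERIV_compose_FDERIV[OF DERIV_phi_powr[OF assms]] has_derivative_nth)
  then show ?thesis
    by (simp add: phi_sum_def[abs_def] phi_dir_def inner_vec_def sum_distrib_left ac_simps)
qed

lemma has_derivative_phi_sum_powr:
  assumes "\<sigma> > 0"
  shows "((\<lambda>x. phi_sum p \<sigma> x powr a) has_derivative
           (\<lambda>h. a * p * phi_sum p \<sigma> x powr (a - 1) * (h \<bullet> phi_dir p \<sigma> x))) (at x)"
proof -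
  have "((\<lambda>s. s powr a) has_real_derivative a * phi_sum p \<sigma> x powr (a - 1)) (at (phi_sum p \<sigma> x))"
    using DERIV_fun_powr[OF DERIV_ident phi_sum_pos[OF assms]] by simp
  from DERIV_compose_FDERIV[OF this has_derivative_phi_sum[OF assms]]
  show ?thesis
    by (simp add: ac_simps)
qed

lemma has_derivative_phi_dir:
  assumes "\<sigma> > 0"
  shows "(phi_dir p \<sigma> has_derivative (\<lambda>h. \<chi> j. phi_curv p \<sigma> x $ j * h $ j)) (at x)"
proof (rule has_derivative_vec_componentwise)
  fix j
  have "((\<lambda>t. phi \<sigma> t powr (p - 1) * erf (t / (sqrt 2 * \<sigma>))) has_real_derivative
        phi_curv p \<sigma> x $ j) (at (x $ j))"
    using DERIV_mult[OF DERIV_phi_powr[OF assms, of "p - 1"] DERIV_erf_scaled[OF assms], of "x $ j"]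
    by (simp add: phi_curv_def algebra_simps power2_eq_square)
  from DERIV_compose_FDERIV[OF this has_derivative_nth]
  show "((\<lambda>x. phi_dir p \<sigma> x $ j) has_derivative (\<lambda>h. (\<chi> j. phi_curv p \<sigma> x $ j * h $ j) $ j)) (at x)"
    by (simp add: phi_dir_def ac_simps)
qed

section \<open>Gradient and Hessian of the objective\<close>

definition H_grad :: "real^'n^'m \<Rightarrow> real^'m \<Rightarrow> real \<Rightarrow> real \<Rightarrow> real \<Rightarrow> real^'n \<Rightarrow> real^'n" where
  "H_grad A b \<tau> p \<sigma> x = 2 *\<^sub>R (transpose A *v (A *v x - b))
     + (2 * \<tau> * phi_sum p \<sigma> x powr ((1 - p) / p)) *\<^sub>R phi_dir p \<sigma> x"

lemma has_derivative_matrix_residual: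
  fixes A :: "real^'n^'m"
  shows "((\<lambda>x. A *v x - b) has_derivative (\<lambda>h. A *v h)) (at x)"
  by (auto intro!: derivative_eq_intros bounded_linear_imp_has_derivative)

lemma GDERIV_H:
  assumes "p > 0" and "\<sigma> > 0"
  shows "GDERIV (H A b \<tau> p \<sigma>) x :> H_grad A b \<tau> p \<sigma> x"
proof -
  let ?r = "\<lambda>x. A *v x - b"
  note r = has_derivative_matrix_residual[of A b x]
  have "1 / p - 1 = (1 - p) / p"
    using assms by (simp add: field_simps)
  then have s: "((\<lambda>x. phi_sum p \<sigma> x powr (1 / p)) has_derivative
      (\<lambda>h. phi_sum p \<sigma> x powr ((1 - p) / p) * (h \<bullet> phi_dir p \<sigma> x))) (at x)"
    using has_derivative_phi_sum_powr[OF assms(2), of p "1 / p" x] assms(1) by simp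
  have "((\<lambda>x. ?r x \<bullet> ?r x + 2 * \<tau> * phi_sum p \<sigma> x powr (1 / p)) has_derivative
      (\<lambda>h. (?r x \<bullet> (A *v h) + (A *v h) \<bullet> ?r x)
         + 2 * \<tau> * (phi_sum p \<sigma> x powr ((1 - p) / p) * (h \<bullet> phi_dir p \<sigma> x)))) (at x)"
    by (intro has_derivative_add has_derivative_inner r has_derivative_mult_right s)
  moreover have "(A *v h) \<bullet> ?r x = h \<bullet> (transpose A *v ?r x)" for h
    by (metis dot_lmul_matrix inner_commute transpose_matrix_vector)
  ultimately show ?thesis
    by (simp add: gderiv_def H_grad_def H_def[abs_def] power2_norm_eq_inner inner_add_right
        inner_commute[of "?r x"] mult.assoc)
qed

lemma outer_square_nth: "outer_square u $ i $ j = u $ i * u $ j"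
  by (simp add: outer_square_def matrix_matrix_mult_def columnvector_def rowvector_def)

lemma outer_square_mult: "outer_square u *v h = (h \<bullet> u) *\<^sub>R u" for u :: "real^'n"
  by (simp add: vec_eq_iff matrix_vector_mult_def outer_square_nth inner_vec_def
      sum_distrib_left sum_distrib_right ac_simps)

lemma Diag_mult: "Diag d *v h = (\<chi> j. d $ j * h $ j)" for d :: "real^'n"
  by (simp add: vec_eq_iff matrix_vector_mult_def Diag_def if_distrib[where f = "\<lambda>a. a * _"] cong: if_cong)

lemma w_eq: "w p \<sigma> x = phi_sum p \<sigma> x powr ((1 - p) / p) *\<^sub>R phi_curv p \<sigma> x"
  by (simp add: w_def phi_curv_def)

text \<open>The Hessian before the factor \<^term>\<open>1 - p\<close>, which is negative for \<open>p > 1\<close>, is written as the square of a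
real or complex root.\<close>

definition H_hess :: "real^'n^'m \<Rightarrow> real \<Rightarrow> real \<Rightarrow> real \<Rightarrow> real^'n \<Rightarrow> real^'n^'n" where
  "H_hess A \<tau> p \<sigma> x = 2 *\<^sub>R (transpose A ** A) + (2 * \<tau>) *\<^sub>R
     (((1 - p) * phi_sum p \<sigma> x powr ((1 - 2 * p) / p)) *\<^sub>R outer_square (phi_dir p \<sigma> x)
       + Diag (w p \<sigma> x))"

lemma has_hessian_H:
  fixes A :: "real^'n^'m"
  assumes "p > 0" and "\<sigma> > 0"
  shows "has_hessian (H A b \<tau> p \<sigma>) (H_hess A \<tau> p \<sigma> x) x"
proof -
  let ?S = "phi_sum p \<sigma>" and ?g = "phi_dir p \<sigma>"
  have e: "(1 - p) / p - 1 = (1 - 2 * p) / p"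
    using assms by (simp add: field_simps)
  have "((\<lambda>x. 2 *\<^sub>R (transpose A *v (A *v x - b))) has_derivative
      (\<lambda>h. 2 *\<^sub>R (transpose A *v (A *v h)))) (at x)"
    by (intro has_derivative_scaleR_right bounded_linear.has_derivative[OF matrix_vector_mul_bounded_linear]
        has_derivative_matrix_residual)
  moreover have "((\<lambda>x. ?S x powr ((1 - p) / p)) has_derivative
      (\<lambda>h. (1 - p) * ?S x powr ((1 - 2 * p) / p) * (h \<bullet> ?g x))) (at x)"
    using has_derivative_phi_sum_powr[OF assms(2), of p "(1 - p) / p" x] assms(1) e by simp
  ultimately have "(H_grad A b \<tau> p \<sigma> has_derivative
     (\<lambda>h. 2 *\<^sub>R (transpose A *v (A *v h)) +
        ((2 * \<tau> * ?S x powr ((1 - p) / p)) *\<^sub>R (\<chi> j. phi_curv p \<sigma> x $ j * h $ j)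
         + (2 * \<tau> * ((1 - p) * ?S x powr ((1 - 2 * p) / p) * (h \<bullet> ?g x))) *\<^sub>R ?g x))) (at x)"
    unfolding H_grad_def[abs_def]
    by (intro has_derivative_add has_derivative_scaleR has_derivative_mult_right
        has_derivative_phi_dir assms)
  also have "(\<lambda>h. 2 *\<^sub>R (transpose A *v (A *v h)) +
        ((2 * \<tau> * ?S x powr ((1 - p) / p)) *\<^sub>R (\<chi> j. phi_curv p \<sigma> x $ j * h $ j)
         + (2 * \<tau> * ((1 - p) * ?S x powr ((1 - 2 * p) / p) * (h \<bullet> ?g x))) *\<^sub>R ?g x))
     = (\<lambda>h. H_hess A \<tau> p \<sigma> x *v h)"
    by (simp add: fun_eq_iff H_hess_def matrix_vector_mult_add_rdistrib scaleR_matrix_vector_assoc[symmetric]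
        outer_square_mult Diag_mult w_eq matrix_vector_mul_assoc vec_eq_iff algebra_simps)
  finally show ?thesis
    unfolding has_hessian_def using GDERIV_H[OF assms]
    by (intro exI[of _ "H_grad A b \<tau> p \<sigma>"] conjI always_eventually allI)
qed

lemma powr_half_square: "s powr (a / (2 * p)) * s powr (a / (2 * p)) = s powr (a / p)" for s :: real
proof -
  have "a / (2 * p) + a / (2 * p) = a / p"
    by (simp add: field_simps)
  then show ?thesis
    by (metis powr_add)
qed

lemma outer_square_v_real:
  assumes "p \<le> 1"
  shows "outer_square (v_real p \<sigma> x) =
     ((1 - p) * phi_sum p \<sigma> x powr ((1 - 2 * p) / p)) *\<^sub>R outer_square (phi_dir p \<sigma> x)"
proof -
  let ?q = "phi_sum p \<sigma> x powr ((1 - 2 * p) / (2 * p))"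
  have "v_real p \<sigma> x $ i * v_real p \<sigma> x $ j =
      (sqrt (1 - p) * sqrt (1 - p)) * (?q * ?q) * (phi_dir p \<sigma> x $ i * phi_dir p \<sigma> x $ j)" for i j
    by (simp only: v_real_def phi_dir_def vec_lambda_beta ac_simps)
  moreover have "sqrt (1 - p) * sqrt (1 - p) = 1 - p"
    using assms by simp
  ultimately show ?thesis
    by (simp only: vec_eq_iff outer_square_nth powr_half_square vector_scaleR_component real_scaleR_def) simp
qed

text \<open>\<^const>\<open>outer_square\<close> does not conjugate, so the two copies of the root multiply to \<open>1 - p\<close> even where the root
is imaginary, and the matrix is real.\<close>

lemma outer_square_v_complex:
  "outer_square (v_complex p \<sigma> x) = map_matrix complex_of_real
     (((1 - p) * phi_sum p \<sigma> x powr ((1 - 2 * p) / p)) *\<^sub>R outer_square (phi_dir p \<sigma> x))"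
proof -
  let ?q = "phi_sum p \<sigma> x powr ((1 - 2 * p) / (2 * p))" and ?k = "csqrt (1 - of_real p)"
  have "v_complex p \<sigma> x $ i * v_complex p \<sigma> x $ j =
      (?k * ?k) * of_real ((?q * ?q) * (phi_dir p \<sigma> x $ i * phi_dir p \<sigma> x $ j))" for i j
    by (simp only: v_complex_def phi_dir_def vec_lambda_beta of_real_mult ac_simps)
  moreover have "?k * ?k = of_real (1 - p)"
    by (simp flip: power2_eq_square)
  ultimately show ?thesis
    by (simp only: vec_eq_iff outer_square_nth powr_half_square nth_map_matrix
        vector_scaleR_component real_scaleR_def of_real_mult) (simp add: mult.assoc)
qed

theorem lemma3p2:
  fixes A :: "real^'n^'m" and b :: "real^'m" and \<tau> p \<sigma> :: real and x :: "real^'n"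
  assumes "\<tau> > 0" and "p > 0" and "\<sigma> > 0"
  shows "(GDERIV (H A b \<tau> p \<sigma>) x :>
            2 *\<^sub>R (transpose A *v (A *v x - b))
            + (2 * \<tau> * phi_sum p \<sigma> x powr ((1 - p) / p)) *\<^sub>R
                (\<chi> j. phi \<sigma> (x $ j) powr (p - 1) * erf (x $ j / (sqrt 2 * \<sigma>))))
    \<and> (p \<le> 1 \<longrightarrow>
         has_hessian (H A b \<tau> p \<sigma>)
           (2 *\<^sub>R (transpose A ** A)
            + (2 * \<tau>) *\<^sub>R (outer_square (v_real p \<sigma> x) + Diag (w p \<sigma> x))) x)
    \<and> (\<exists>M. has_hessian (H A b \<tau> p \<sigma>) M x
         \<and> map_matrix complex_of_real M =
             2 *\<^sub>R map_matrix complex_of_real (transpose A ** A)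
             + (2 * \<tau>) *\<^sub>R (outer_square (v_complex p \<sigma> x)
                            + map_matrix complex_of_real (Diag (w p \<sigma> x))))"
proof (intro conjI impI exI)
  show "GDERIV (H A b \<tau> p \<sigma>) x :> 2 *\<^sub>R (transpose A *v (A *v x - b))
      + (2 * \<tau> * phi_sum p \<sigma> x powr ((1 - p) / p)) *\<^sub>R
          (\<chi> j. phi \<sigma> (x $ j) powr (p - 1) * erf (x $ j / (sqrt 2 * \<sigma>)))"
    using GDERIV_H[OF assms(2,3)] by (simp add: H_grad_def phi_dir_def)
  show "has_hessian (H A b \<tau> p \<sigma>) (2 *\<^sub>R (transpose A ** A)
      + (2 * \<tau>) *\<^sub>R (outer_square (v_real p \<sigma> x) + Diag (w p \<sigma> x))) x" if "p \<le> 1"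
    using has_hessian_H[OF assms(2,3)] by (simp add: H_hess_def outer_square_v_real[OF that])
  show "has_hessian (H A b \<tau> p \<sigma>) (H_hess A \<tau> p \<sigma> x) x"
    by (rule has_hessian_H[OF assms(2,3)])
  show "map_matrix complex_of_real (H_hess A \<tau> p \<sigma> x) =
      2 *\<^sub>R map_matrix complex_of_real (transpose A ** A)
      + (2 * \<tau>) *\<^sub>R (outer_square (v_complex p \<sigma> x) + map_matrix complex_of_real (Diag (w p \<sigma> x)))"
    by (simp add: outer_square_v_complex H_hess_def vec_eq_iff scaleR_conv_of_real[where 'a = complex])
qed

end
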